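(* Suppose that $f(\mathcal{M})$ is strictly convex with respect to each block component and that it is minimized exactly for each block component subproblem of the CP-APR algorithm described in the context. Let $\{\mathcal{M}_k\}$, $\mathcal{M}_k=[\![\lambda_k;A^{(1)}_k,\dots,A^{(N)}_k]\!]$, be the sequence of outer iterates produced by CP-APR from an initial guess lying in $\Omega(\zeta)$ for some $\zeta>0$, and let $\mathcal{M}_*=[\![\lambda_*;A^{(1)}_*,\dots,A^{(N)}_*]\!]$ be a limit point of $\{\mathcal{M}_k\}$ such that $\lambda_*>0$ (entrywise). Then $\mathcal{M}_*$ is a KKT point of the problem $\min f(\mathcal{M})$ subject to $\mathcal{M}\in\Omega$.
   Context: Data: $\mathcal{X}=(x_{\mathbf i})$ is a nonnegative (count) data tensor of size $I_1\times\cdots\times I_N$, with $\mathbf i=(i_1,\dots,i_N)$, and $R\ge1$ is the number of components. Model: for $\lambda\in\mathbb{R}^R$ and matrices $A^{(n)}\in\mathbb{R}^{I_n\times R}$ ($n=1,\dots,N$), $\mathcal{M}=[\![\lambda;A^{(1)},\dots,A^{(N)}]\!]$ denotes the tensor with entries $m_{\mathbf i}=\sum_{r=1}^R\lambda_r\prod_{n=1}^N a^{(n)}_{i_n r}$; if $\lambda$ is omitted it is the all-ones vector. Depending on context, $\mathcal{M}$ denotes the tensor itself or its constituent parts $(\lambda,A^{(1)},\dots,A^{(N)})$; membership in $\Omega$, convex combinations and limit points refer to the constituent parts. Objective: $f(\mathcal{M})=\sum_{\mathbf i}\big(m_{\mathbf i}-x_{\mathbf i}\log m_{\mathbf i}\big)$,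 with the convention $0\cdot\log\mu=0$ for all $\mu\ge0$, and $f(\mathcal{M})=+\infty$ if some $m_{\mathbf i}=0$ with $x_{\mathbf i}>0$. Feasible set: $\Omega=\Omega_\lambda\times\Omega_1\times\cdots\times\Omega_N$, with $\Omega_\lambda=[0,+\infty)^R$ and $\Omega_n=\{A\in[0,1]^{I_n\times R}:\ \text{each column of }A\text{ has 1-norm }1\}$. For $\zeta>0$, $\Omega(\zeta)$ is the convex hull of $\{\mathcal{M}\in\Omega: f(\mathcal{M})\le\zeta\}$. Block components: using the scaling ambiguity, the weights can be absorbed into the $n$th mode, $\mathcal{M}=[\![A^{(1)},\dots,A^{(n-1)},B^{(n)},A^{(n+1)},\dots,A^{(N)}]\!]$ with $B^{(n)}=A^{(n)}\,\mathrm{diag}(\lambda)$. The $n$th block component is the nonnegative matrix $B^{(n)}$, and $f$ restricted to the $n$th block is the function $f_n(B)=f([\![A^{(1)},\dots,A^{(n-1)},B,A^{(n+1)},\dots,A^{(N)}]\!])$ of $B\ge0$, the other factor matrices being held fixed. The $n$th block component subproblem is $\min_{B\ge0}f_n(B)$. CP-APR (ideal version): start from an initial guess in $\Omega(\zeta)$ for some $\zeta>0$. Each outer iteration starts from the current $\mathcal{M}_k$ and loops over $n=1,\dots,N$. In step $n$, with the current factor matrices fixed (those already updated for modes $<n$, the old ones for modes $>n$), compute $B^{(n)}_{k+1}\in\arg\min_{B\ge0}f([\![A^{(1)}_{k+1},\dots,A^{(n-1)}_{k+1},B,A^{(n+1)}_k,\dots,A^{(N)}_k]\!])$; then set $\lambda_r$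 equal to the sum of the $r$th column of $B^{(n)}_{k+1}$ and let $A^{(n)}_{k+1}$ be $B^{(n)}_{k+1}$ with its columns normalized to sum to one (if the $r$th column of $B^{(n)}_{k+1}$ is zero, set $\lambda_r=0$ and take the $r$th column of $A^{(n)}_{k+1}$ to be an arbitrary nonnegative vector summing to one). After step $N$, $\lambda_{k+1}$ is the current $\lambda$ and $\mathcal{M}_{k+1}=[\![\lambda_{k+1};A^{(1)}_{k+1},\dots,A^{(N)}_{k+1}]\!]$. KKT point: a feasible point at which the Karush-Kuhn-Tucker conditions hold for minimizing $f$ subject to the nonnegativity constraints on $\lambda$ and all $A^{(n)}$ and the equality constraints that each column of each $A^{(n)}$ sums to 1 (the upper bounds by 1 on the entries being redundant). *)

theory Defs
  imports "HOL-Analysis.Analysis"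
begin

text \<open>
  Encoding. Modes are the elements of a finite linearly ordered type \<open>'n\<close>, and components the
  elements of a finite type \<open>'r\<close>. Since the modes have different sizes, the rows of the \<open>n\<close>-th
  factor matrix are indexed by a subset \<open>I n\<close> of one common finite type \<open>'i\<close>. A matrix with row
  index set \<open>J\<close> is a \<open>real^'r^'i\<close> whose rows outside \<open>J\<close> are zero, so that two such matrices are
  equal iff they agree on \<open>J\<close>.
  The constituent parts of a model form a pair \<open>(l, A)\<close> of the weights and the factor matrices.
\<close>

type_synonym ('r, 'i) factor = "real^'r^'i"
type_synonym ('r, 'i, 'n) factors = "('r, 'i) factor^'n"
type_synonym ('r, 'i, 'n) ktensor = "(real^'r) \<times> ('r, 'i, 'n) factors"
type_synonym ('i, 'n) tensor = "('n \<Rightarrow> 'i) \<Rightarrow> real"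

definition multi_indices :: "('n \<Rightarrow> 'i set) \<Rightarrow> ('n \<Rightarrow> 'i) set" where
  "multi_indices I = {i. \<forall>n. i n \<in> I n}"

definition entry :: "('r::finite, 'i::finite, 'n::finite) ktensor \<Rightarrow> ('i, 'n) tensor" where
  "entry M i = (\<Sum>r\<in>UNIV. fst M $ r * (\<Prod>n\<in>UNIV. snd M $ n $ i n $ r))"

text \<open>
  One summand \<open>m - x log m\<close>. The argument \<open>m\<close> is nonnegative for feasible models; the value for
  \<open>m < 0 < x\<close> is immaterial.
\<close>

definition loss :: "real \<Rightarrow> real \<Rightarrow> ereal" where
  "loss x m = (if x = 0 then ereal m else if m \<le> 0 then \<infinity> else ereal (m - x * ln m))"

definition objective ::
  "('n \<Rightarrow> 'i set) \<Rightarrow> ('i, 'n) tensor \<Rightarrow> ('r::finite, 'i::finite, 'n::finite) ktensor \<Rightarrow> ereal" where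
  "objective I x M = (\<Sum>i\<in>multi_indices I. loss (x i) (entry M i))"

definition nonneg_matrices :: "'i set \<Rightarrow> ('r::finite, 'i::finite) factor set" where
  "nonneg_matrices J = {B. (\<forall>i r. 0 \<le> B $ i $ r) \<and> (\<forall>i. i \<notin> J \<longrightarrow> B $ i = 0)}"

definition Omega_weights :: "(real^'r::finite) set" where
  "Omega_weights = {l. \<forall>r. 0 \<le> l $ r}"

definition Omega_factor :: "'i set \<Rightarrow> ('r::finite, 'i::finite) factor set" where
  "Omega_factor J =
    {A. (\<forall>i\<in>J. \<forall>r. A $ i $ r \<in> {0..1}) \<and> (\<forall>i. i \<notin> J \<longrightarrow> A $ i = 0) \<and>
        (\<forall>r. (\<Sum>i\<in>J. \<bar>A $ i $ r\<bar>) = 1)}"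

definition Omega :: "('n \<Rightarrow> 'i set) \<Rightarrow> ('r::finite, 'i::finite, 'n::finite) ktensor set" where
  "Omega I = Omega_weights \<times> {A. \<forall>n. A $ n \<in> Omega_factor (I n)}"

definition Omega_level ::
  "('n \<Rightarrow> 'i set) \<Rightarrow> ('i, 'n) tensor \<Rightarrow> real \<Rightarrow> ('r::finite, 'i::finite, 'n::finite) ktensor set" where
  "Omega_level I x \<zeta> = convex hull {M \<in> Omega I. objective I x M \<le> ereal \<zeta>}"

text \<open>
  The function of the \<open>n\<close>-th block component: the matrix \<open>B\<close>, into which the weights have been
  absorbed, takes the place of \<open>A $ n\<close>, which is ignored.
\<close>

definition block_objective ::
  "('n \<Rightarrow> 'i set) \<Rightarrow> ('i, 'n) tensor \<Rightarrow> ('r::finite, 'i::finite, 'n::finite) factors \<Rightarrow>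
    'n \<Rightarrow> ('r, 'i) factor \<Rightarrow> ereal" where
  "block_objective I x A n B = objective I x (\<chi> r. 1, \<chi> m. if m = n then B else A $ m)"

text \<open>Strict convexity of an extended real valued function, i.e. on its effective domain.\<close>

definition strictly_convex_on :: "'a::real_vector set \<Rightarrow> ('a \<Rightarrow> ereal) \<Rightarrow> bool" where
  "strictly_convex_on S g \<longleftrightarrow> convex S \<and>
    (\<forall>B\<in>S. \<forall>C\<in>S. \<forall>t. B \<noteq> C \<and> g B < \<infinity> \<and> g C < \<infinity> \<and> 0 < t \<and> t < 1 \<longrightarrow>
      g (t *\<^sub>R B + (1 - t) *\<^sub>R C) < ereal t * g B + ereal (1 - t) * g C)"

text \<open>
  Strict convexity is a property of the \<open>n\<close>-th block for given other factor matrices. It cannot be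
  required for all feasible \<open>A\<close>: with at least two components and the columns of the other
  factors all equal, the block function depends on the row sums of \<open>B\<close> only.
\<close>

definition block_strictly_convex ::
  "('n \<Rightarrow> 'i set) \<Rightarrow> ('i, 'n) tensor \<Rightarrow> ('r::finite, 'i::finite, 'n::finite) factors \<Rightarrow> 'n \<Rightarrow> bool" where
  "block_strictly_convex I x A n \<longleftrightarrow>
    strictly_convex_on (nonneg_matrices (I n)) (block_objective I x A n)"

definition block_minimizer ::
  "('n \<Rightarrow> 'i set) \<Rightarrow> ('i, 'n) tensor \<Rightarrow> ('r::finite, 'i::finite, 'n::finite) factors \<Rightarrow>
    'n \<Rightarrow> ('r, 'i) factor \<Rightarrow> bool" where
  "block_minimizer I x A n B \<longleftrightarrow>
    is_arg_min (block_objective I x A n) (\<lambda>C. C \<in> nonneg_matrices (I n)) B"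

definition column_sums :: "'i set \<Rightarrow> ('r::finite, 'i::finite) factor \<Rightarrow> real^'r" where
  "column_sums J B = (\<chi> r. \<Sum>i\<in>J. B $ i $ r)"

text \<open>
  A zero column of \<open>B\<close> may be normalized to any nonnegative column summing to one, hence a
  relation.
\<close>

definition column_normalization ::
  "'i set \<Rightarrow> ('r::finite, 'i::finite) factor \<Rightarrow> ('r, 'i) factor \<Rightarrow> bool" where
  "column_normalization J B A \<longleftrightarrow> A \<in> nonneg_matrices J \<and>
    (\<forall>r. if \<forall>i\<in>J. B $ i $ r = 0 then (\<Sum>i\<in>J. A $ i $ r) = 1
         else \<forall>i\<in>J. A $ i $ r = B $ i $ r / column_sums J B $ r)"

definition sweep_factors ::
  "('r::finite, 'i::finite, 'n::{finite,linorder}) factors \<Rightarrow> ('r, 'i, 'n) factors \<Rightarrow> 'n \<Rightarrow>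
    ('r, 'i, 'n) factors" where
  "sweep_factors A A' n = (\<chi> m. if m < n then A' $ m else A $ m)"

text \<open>
  One outer iteration. The weights computed in a step are used by no later step of the same
  sweep, so only those of the last mode are recorded.
\<close>

definition cpapr_iteration ::
  "('n \<Rightarrow> 'i set) \<Rightarrow> ('i, 'n) tensor \<Rightarrow> ('r::finite, 'i::finite, 'n::{finite,linorder}) ktensor \<Rightarrow>
    ('r, 'i, 'n) ktensor \<Rightarrow> bool" where
  "cpapr_iteration I x M M' \<longleftrightarrow>
    (\<exists>B :: ('r, 'i, 'n) factors.
      (\<forall>n. block_minimizer I x (sweep_factors (snd M) (snd M') n) n (B $ n) \<and>
           column_normalization (I n) (B $ n) (snd M' $ n)) \<and>
      fst M' = column_sums (I (Max UNIV)) (B $ Max UNIV))"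

definition cpapr_sequence ::
  "('n \<Rightarrow> 'i set) \<Rightarrow> ('i, 'n) tensor \<Rightarrow>
    (nat \<Rightarrow> ('r::finite, 'i::finite, 'n::{finite,linorder}) ktensor) \<Rightarrow> bool" where
  "cpapr_sequence I x M \<longleftrightarrow> (\<forall>k. cpapr_iteration I x (M k) (M (Suc k)))"

text \<open>
  The multipliers \<open>\<mu>\<close> and \<open>\<upsilon>\<close> belong to the nonnegativity constraints, \<open>\<eta>\<close> to the column sums.
\<close>

definition lagrangian ::
  "('n \<Rightarrow> 'i set) \<Rightarrow> ('i, 'n) tensor \<Rightarrow> real^'r \<Rightarrow> real^'r^'i^'n \<Rightarrow> real^'r^'n \<Rightarrow>
    ('r::finite, 'i::finite, 'n::finite) ktensor \<Rightarrow> real" where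
  "lagrangian I x \<mu> \<upsilon> \<eta> M = real_of_ereal (objective I x M)
    - (\<Sum>r\<in>UNIV. \<mu> $ r * fst M $ r)
    - (\<Sum>n\<in>UNIV. \<Sum>i\<in>I n. \<Sum>r\<in>UNIV. \<upsilon> $ n $ i $ r * snd M $ n $ i $ r)
    - (\<Sum>n\<in>UNIV. \<Sum>r\<in>UNIV. \<eta> $ n $ r * ((\<Sum>i\<in>I n. snd M $ n $ i $ r) - 1))"

text \<open>
  The objective has to be finite at a KKT point; it is then finite in a neighbourhood, also at
  infeasible points, so that the derivative of \<open>real_of_ereal (objective I x M)\<close> is meaningful.
\<close>

definition KKT_point ::
  "('n \<Rightarrow> 'i set) \<Rightarrow> ('i, 'n) tensor \<Rightarrow> ('r::finite, 'i::finite, 'n::finite) ktensor \<Rightarrow> bool" where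
  "KKT_point I x M \<longleftrightarrow> M \<in> Omega I \<and> objective I x M < \<infinity> \<and>
    (\<exists>\<mu> \<upsilon> \<eta>.
      (\<forall>r. 0 \<le> \<mu> $ r \<and> \<mu> $ r * fst M $ r = 0) \<and>
      (\<forall>n. \<forall>i\<in>I n. \<forall>r. 0 \<le> \<upsilon> $ n $ i $ r \<and> \<upsilon> $ n $ i $ r * snd M $ n $ i $ r = 0) \<and>
      (lagrangian I x \<mu> \<upsilon> \<eta> has_derivative (\<lambda>_. 0)) (at M))"

end

theory Submission
  imports Defs
begin

text \<open>
  Why a limit point \<open>M\<^sub>*\<close> with positive weights is a KKT point.

  The constraints that the columns sum to one carry no multiplier here: by the scaling ambiguity a
  factor together with the weights is the same thing as one nonnegative matrix
  (\<open>block_objective_scale_columns\<close>), so the optimality of a block subproblem says that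
  \<open>f\<close> cannot be decreased by changing the weights alone, or one factor alone, to anything
  nonnegative. One-sided derivatives along the coordinate axes then give the KKT conditions with
  \<open>\<eta> = 0\<close> and with the partial derivatives of \<open>f\<close> as the other multipliers
  (\<open>KKT_point_of_blockwise_minimum\<close>). Differentiability is no problem, since \<open>f\<close> is finite
  at \<open>M\<^sub>*\<close>. It remains to see that \<open>M\<^sub>*\<close> solves each of its own block subproblems.

  Within a sweep the values of the successive subproblems decrease, from the value at one outer
  iterate to the value at the next one (\<open>cpapr_iteration_descent\<close>). As an extended real valued
  function \<open>f\<close> is continuous on nonnegative models (\<open>tendsto_objective\<close>), so all these
  values, taken along the subsequence that converges to \<open>M\<^sub>*\<close>, tend to \<open>f(M\<^sub>*)\<close>.

  Suppose that the factors used in step \<open>n\<close> tend to those of \<open>M\<^sub>*\<close>. The minimizers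
  \<open>B\<^sup>n\<close> stay bounded, because the objective controls the sum of their entries
  (\<open>block_objective_coercive\<close>). Every cluster point of them, and also the matrix
  \<open>A\<^sub>*\<^sup>n diag(\<lambda>\<^sub>*)\<close>, attains the limit value \<open>f(M\<^sub>*)\<close>, which is the
  minimum of the limiting block function; strict convexity at the limit makes them equal
  (\<open>block_minimizers_converge\<close>). Since \<open>\<lambda>\<^sub>* > 0\<close>, normalization is continuous there,
  and the new \<open>n\<close>-th factor tends to \<open>A\<^sub>*\<^sup>n\<close> as well
  (\<open>tendsto_column_normalization\<close>). Hence the factors used in the next step again tend to those
  of \<open>M\<^sub>*\<close>, and induction on \<open>n\<close> reaches every mode.
\<close>

section \<open>The summands of the objective\<close>

text \<open>
  The delicate case is \<open>m\<close> tending to \<open>0\<close> with \<open>x > 0\<close>, where the loss tends to its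
  value \<open>\<infinity>\<close>. Keeping \<open>\<infinity>\<close> as a value makes the limit argument uniform: finiteness at a
  limit point follows from bounded objective values instead of having to be known beforehand.
\<close>

lemma loss_tendsto:
  assumes "0 \<le> x" "(m \<longlongrightarrow> m0) F" "\<forall>\<^sub>F k in F. 0 \<le> m k" "0 \<le> m0"
  shows "((\<lambda>k. loss x (m k)) \<longlongrightarrow> loss x m0) F"
proof (cases "x = 0")
  case True
  then show ?thesis using assms(2) by (simp add: loss_def)
next
  case False
  then have x: "0 < x" using assms(1) by simp
  show ?thesis
  proof (cases "m0 = 0")
    case True
    have "\<forall>\<^sub>F k in F. ereal r < loss x (m k)" for r
    proof -
      have "\<forall>\<^sub>F k in F. m k < exp (- r / x)"
        using order_tendstoD(2)[OF assms(2)] True by simp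
      then show ?thesis using assms(3)
      proof eventually_elim
        case (elim k)
        show ?case
        proof (cases "m k = 0")
          case True
          then show ?thesis using x by (simp add: loss_def)
        next
          case False
          then have pos: "0 < m k" using elim by simp
          have "ln (m k) < - r / x" using elim(1) pos by (metis ln_exp ln_less_cancel_iff exp_gt_zero)
          then have "r < - (x * ln (m k))" using x by (simp add: field_simps)
          then show ?thesis using pos x by (simp add: loss_def)
        qed
      qed
    qed
    then have "((\<lambda>k. loss x (m k)) \<longlongrightarrow> \<infinity>) F" by (simp add: tendsto_PInfty)
    then show ?thesis using True x by (simp add: loss_def)
  next
    case False
    then have m0: "0 < m0" using assms(4) by simp
    then have "((\<lambda>k. ereal (m k - x * ln (m k))) \<longlongrightarrow> ereal (m0 - x * ln m0)) F"
      using assms(2) by (auto intro!: tendsto_intros)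
    moreover have "\<forall>\<^sub>F k in F. ereal (m k - x * ln (m k)) = loss x (m k)"
      using order_tendstoD(1)[OF assms(2) m0]
      by eventually_elim (use x in \<open>simp add: loss_def\<close>)
    ultimately have "((\<lambda>k. loss x (m k)) \<longlongrightarrow> ereal (m0 - x * ln m0)) F"
      by (rule Lim_transform_eventually)
    then show ?thesis using m0 x by (simp add: loss_def)
  qed
qed

lemma loss_not_MInfty [simp]: "loss x m \<noteq> - \<infinity>"
  by (simp add: loss_def)

text \<open>
  The loss grows at least like \<open>m / 2\<close>: this is \<open>ln y \<le> y - 1\<close> at \<open>y = m / (2 x)\<close>. For
  \<open>x = 0\<close> the constant vanishes.
\<close>

lemma loss_lower_bound:
  assumes "0 \<le> x" "0 \<le> m"
  shows "ereal (m / 2 - x * ln (2 * x)) \<le> loss x m"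
proof (cases "x = 0 \<or> m = 0")
  case True
  then show ?thesis using assms by (auto simp: loss_def)
next
  case False
  then have pos: "0 < x" "0 < m" using assms by auto
  have "ln (m / (2 * x)) \<le> m / (2 * x) - 1"
    using pos by (intro ln_le_minus_one) simp
  then have "x * ln (m / (2 * x)) \<le> x * (m / (2 * x) - 1)"
    using pos by simp
  also have "\<dots> = m / 2 - x" using pos by (simp add: field_simps)
  finally have "x * ln m - x * ln (2 * x) \<le> m / 2 - x"
    using pos by (simp add: ln_div right_diff_distrib)
  then show ?thesis using pos by (simp add: loss_def)
qed

section \<open>Nonnegative models\<close>

definition nonneg_ktensor :: "('r::finite, 'i::finite, 'n::finite) ktensor \<Rightarrow> bool" where
  "nonneg_ktensor M \<longleftrightarrow> (\<forall>r. 0 \<le> fst M $ r) \<and> (\<forall>n i r. 0 \<le> snd M $ n $ i $ r)"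

lemma finite_multi_indices [simp]:
  fixes I :: "'n::finite \<Rightarrow> 'i::finite set"
  shows "finite (multi_indices I)"
  by (rule finite_subset[OF subset_UNIV]) simp

lemma entry_nonneg: "nonneg_ktensor M \<Longrightarrow> 0 \<le> entry M i"
  by (simp add: entry_def nonneg_ktensor_def sum_nonneg prod_nonneg)

lemma entry_pos_iff:
  assumes "nonneg_ktensor M"
  shows "0 < entry M i \<longleftrightarrow> (\<exists>r. 0 < fst M $ r \<and> (\<forall>n. 0 < snd M $ n $ i n $ r))"
proof -
  have nn: "0 \<le> fst M $ r" "0 \<le> snd M $ n $ j $ r" for r n j
    using assms by (auto simp: nonneg_ktensor_def)
  have ge: "0 \<le> fst M $ r * (\<Prod>n\<in>UNIV. snd M $ n $ i n $ r)" for r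
    using nn by (simp add: prod_nonneg)
  have "entry M i = 0 \<longleftrightarrow> (\<forall>r. fst M $ r * (\<Prod>n\<in>UNIV. snd M $ n $ i n $ r) = 0)"
    unfolding entry_def using ge by (subst sum_nonneg_eq_0_iff) auto
  also have "\<dots> \<longleftrightarrow> (\<forall>r. fst M $ r = 0 \<or> (\<exists>n. snd M $ n $ i n $ r = 0))"
    by simp
  finally show ?thesis
    using entry_nonneg[OF assms, of i] nn by (metis less_eq_real_def less_irrefl)
qed

lemma tendsto_entry:
  assumes "(X \<longlongrightarrow> M) F"
  shows "((\<lambda>k. entry (X k) i) \<longlongrightarrow> entry M i) F"
  unfolding entry_def
  by (intro tendsto_sum tendsto_mult tendsto_prod tendsto_vec_nth tendsto_fst tendsto_snd assms)

lemma sum_not_MInfty: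
  fixes f :: "'a \<Rightarrow> ereal"
  shows "(\<And>i. i \<in> J \<Longrightarrow> f i \<noteq> - \<infinity>) \<Longrightarrow> sum f J \<noteq> - \<infinity>"
  by (induction J rule: infinite_finite_induct) (auto simp: ereal_plus_eq_MInfty)

lemma objective_not_MInfty [simp]: "objective I x M \<noteq> - \<infinity>"
  unfolding objective_def by (rule sum_not_MInfty) simp

lemma tendsto_objective:
  fixes X :: "'a \<Rightarrow> ('r::finite, 'i::finite, 'n::finite) ktensor"
  assumes data: "\<And>i. i \<in> multi_indices I \<Longrightarrow> 0 \<le> x i"
    and "(X \<longlongrightarrow> M) F" "\<forall>\<^sub>F k in F. nonneg_ktensor (X k)" "nonneg_ktensor M"
  shows "((\<lambda>k. objective I x (X k)) \<longlongrightarrow> objective I x M) F"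
proof -
  have "((\<lambda>k. \<Sum>i\<in>J. loss (x i) (entry (X k) i)) \<longlongrightarrow> (\<Sum>i\<in>J. loss (x i) (entry M i))) F"
    if "finite J" "J \<subseteq> multi_indices I" for J
    using that
  proof (induction J)
    case (insert j J)
    have "((\<lambda>k. loss (x j) (entry (X k) j)) \<longlongrightarrow> loss (x j) (entry M j)) F"
      using insert.prems assms
      by (intro loss_tendsto tendsto_entry) (auto intro: entry_nonneg elim: eventually_mono)
    moreover have "(\<Sum>i\<in>J. loss (x i) (entry M i)) \<noteq> - \<infinity>"
      by (rule sum_not_MInfty) simp
    ultimately show ?case
      using insert by (auto intro!: tendsto_add_ereal_general)
  qed simp
  then show ?thesis unfolding objective_def by simp
qed

lemma objective_finite_iff:
  "objective I x M < \<infinity> \<longleftrightarrow> (\<forall>i\<in>multi_indices I. x i \<noteq> 0 \<longrightarrow> 0 < entry M i)"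
  for M :: "('r::finite, 'i::finite, 'n::finite) ktensor"
  unfolding objective_def less_top[symmetric] top_ereal_def[symmetric]
  by (subst top_ereal_def, subst sum_Pinfty) (auto simp: loss_def not_le)

text \<open>
  In the form with the conditional, summands with \<open>x = 0\<close> are linear in the entry, hence
  differentiable even where the entry vanishes.
\<close>

lemma objective_eq_real:
  assumes "objective I x M < \<infinity>"
  shows "objective I x M =
    ereal (\<Sum>i\<in>multi_indices I. entry M i - (if x i = 0 then 0 else x i * ln (entry M i)))"
proof -
  have "loss (x i) (entry M i) =
      ereal (entry M i - (if x i = 0 then 0 else x i * ln (entry M i)))"
    if "i \<in> multi_indices I" for i
    using that assms[unfolded objective_finite_iff] by (auto simp: loss_def)
  then show ?thesis unfolding objective_def by (simp flip: sum_ereal)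
qed

section \<open>The feasible set\<close>

text \<open>
  The upper bound by one follows from nonnegativity and the column sums.
\<close>

lemma Omega_factor_eq:
  fixes J :: "'i::finite set"
  shows "(Omega_factor J :: ('r::finite, 'i) factor set) =
    {A \<in> nonneg_matrices J. column_sums J A = (\<chi> r. 1)}"
proof -
  have "(\<forall>i\<in>J. \<forall>r. A $ i $ r \<in> {0..1}) \<and> (\<forall>i. i \<notin> J \<longrightarrow> A $ i = 0) \<and>
      (\<forall>r. (\<Sum>i\<in>J. \<bar>A $ i $ r\<bar>) = 1) \<longleftrightarrow>
      (\<forall>i r. 0 \<le> A $ i $ r) \<and> (\<forall>i. i \<notin> J \<longrightarrow> A $ i = 0) \<and> (\<forall>r. (\<Sum>i\<in>J. A $ i $ r) = 1)"
    (is "?L \<longleftrightarrow> ?R") for A :: "('r, 'i) factor"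
  proof
    assume L: ?L
    then have nn: "0 \<le> A $ i $ r" for i r
      by (cases "i \<in> J") auto
    with L show ?R by simp
  next
    assume R: ?R
    have "A $ i $ r \<le> 1" if "i \<in> J" for i r
      using R member_le_sum[of i J "\<lambda>i. A $ i $ r"] that by auto
    with R show ?L by simp
  qed
  moreover have "column_sums J A = (\<chi> r. 1) \<longleftrightarrow> (\<forall>r. (\<Sum>i\<in>J. A $ i $ r) = 1)"
    for A :: "('r, 'i) factor"
    by (simp add: column_sums_def vec_eq_iff)
  ultimately show ?thesis
    unfolding Omega_factor_def nonneg_matrices_def
    by (intro set_eqI) (simp only: mem_Collect_eq conj_assoc)
qed

lemma Omega_imp_nonneg: "M \<in> Omega I \<Longrightarrow> nonneg_ktensor M"
  by (auto simp: Omega_def Omega_weights_def Omega_factor_eq nonneg_matrices_def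
      nonneg_ktensor_def)

lemma convex_nonneg_matrices: "convex (nonneg_matrices J)"
  by (auto simp: convex_def nonneg_matrices_def)

lemma column_sums_combination:
  "column_sums J (u *\<^sub>R A + v *\<^sub>R B) = u *\<^sub>R column_sums J A + v *\<^sub>R column_sums J B"
  by (simp add: column_sums_def vec_eq_iff sum.distrib sum_distrib_left)

lemma convex_Omega:
  fixes I :: "'n::finite \<Rightarrow> 'i::finite set"
  shows "convex (Omega I :: ('r::finite, 'i, 'n) ktensor set)"
proof -
  have "convex (Omega_factor (I n) :: ('r, 'i) factor set)" for n
    using convex_nonneg_matrices[of "I n"]
    by (auto simp: convex_def Omega_factor_eq column_sums_combination vec_eq_iff)
  then have "convex {A :: ('r, 'i, 'n) factors. \<forall>n. A $ n \<in> Omega_factor (I n)}"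
    by (auto simp: convex_def)
  moreover have "convex (Omega_weights :: (real^'r) set)"
    by (auto simp: convex_def Omega_weights_def)
  ultimately show ?thesis
    unfolding Omega_def by (intro convex_Times)
qed

lemma closed_nonneg_matrices: "closed (nonneg_matrices J)"
  unfolding nonneg_matrices_def
  by (intro closed_Collect_conj closed_Collect_all closed_Collect_imp closed_Collect_le
      closed_Collect_eq continuous_intros) auto

lemma closed_Omega:
  fixes I :: "'n::finite \<Rightarrow> 'i::finite set"
  shows "closed (Omega I :: ('r::finite, 'i, 'n) ktensor set)"
proof -
  have "closed (Omega_factor (I n) :: ('r, 'i) factor set)" for n
  proof -
    have "Omega_factor (I n) =
        nonneg_matrices (I n) \<inter> {A :: ('r, 'i) factor. column_sums (I n) A = (\<chi> r. 1)}"
      by (auto simp: Omega_factor_eq)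
    moreover have "closed {A :: ('r, 'i) factor. column_sums (I n) A = (\<chi> r. 1)}"
      unfolding column_sums_def by (intro closed_Collect_eq continuous_intros)
    ultimately show ?thesis by (simp add: closed_Int closed_nonneg_matrices)
  qed
  then have "closed {A :: ('r, 'i, 'n) factors. \<forall>n. A $ n \<in> Omega_factor (I n)}"
    by (intro closed_Collect_all) (auto intro!: closed_vimage[unfolded vimage_def] continuous_intros)
  moreover have "closed (Omega_weights :: (real^'r) set)"
    unfolding Omega_weights_def
    by (intro closed_Collect_all closed_Collect_le continuous_intros)
  ultimately show ?thesis
    unfolding Omega_def by (rule closed_Times[rotated])
qed

text \<open>
  Although the objective is not convex in all constituent parts jointly, its effective domain in
  \<open>Omega I\<close> is: if a component \<open>r\<close> has all its coefficients for the index \<open>i\<close> positive in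
  \<open>X\<close>, the same holds for every combination that gives \<open>X\<close> positive weight. So passing to
  the convex hull of a level set does not lose finiteness.
\<close>

lemma Omega_level_imp_finite:
  fixes M :: "('r::finite, 'i::finite, 'n::finite) ktensor"
  assumes "M \<in> Omega_level I x \<zeta>"
  shows "M \<in> Omega I" "objective I x M < \<infinity>"
proof -
  have half: "0 < entry (u *\<^sub>R X + v *\<^sub>R Y) i"
    if "nonneg_ktensor X" "nonneg_ktensor Y" "0 < entry X i" "0 < u" "0 \<le> v"
    for X Y :: "('r, 'i, 'n) ktensor" and u v i
  proof -
    have nn: "nonneg_ktensor (u *\<^sub>R X + v *\<^sub>R Y)"
      using that by (simp add: nonneg_ktensor_def)
    from that have "\<exists>r. 0 < fst X $ r \<and> (\<forall>n. 0 < snd X $ n $ i n $ r)"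
      by (simp add: entry_pos_iff)
    then obtain r where "0 < fst X $ r" "\<And>n. 0 < snd X $ n $ i n $ r" by blast
    then show ?thesis
      using that unfolding entry_pos_iff[OF nn]
      by (intro exI[of _ r]) (simp add: nonneg_ktensor_def add_pos_nonneg)
  qed
  have "convex {X \<in> Omega I :: ('r, 'i, 'n) ktensor set. objective I x X < \<infinity>}"
  proof (rule convexI)
    fix X Y :: "('r, 'i, 'n) ktensor" and u v :: real
    assume X: "X \<in> {X \<in> Omega I. objective I x X < \<infinity>}"
      and Y: "Y \<in> {X \<in> Omega I. objective I x X < \<infinity>}"
      and uv: "0 \<le> u" "0 \<le> v" "u + v = 1"
    have "u *\<^sub>R X + v *\<^sub>R Y \<in> Omega I"
      using X Y uv convex_Omega[of I] by (auto simp: convex_def)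
    moreover have "0 < entry (u *\<^sub>R X + v *\<^sub>R Y) i"
      if i: "i \<in> multi_indices I" "x i \<noteq> 0" for i
    proof (cases "0 < u")
      case True
      then show ?thesis
        using X Y uv i Omega_imp_nonneg unfolding objective_finite_iff mem_Collect_eq
        by (intro half) blast+
    next
      case False
      then have "0 < v" using uv by simp
      then have "0 < entry (v *\<^sub>R Y + u *\<^sub>R X) i"
        using X Y uv i Omega_imp_nonneg unfolding objective_finite_iff mem_Collect_eq
        by (intro half) blast+
      then show ?thesis by (simp add: add.commute)
    qed
    ultimately show "u *\<^sub>R X + v *\<^sub>R Y \<in> {X \<in> Omega I. objective I x X < \<infinity>}"
      unfolding mem_Collect_eq objective_finite_iff by blast
  qed
  then have "Omega_level I x \<zeta> \<subseteq> {X \<in> Omega I :: ('r, 'i, 'n) ktensor set. objective I x X < \<infinity>}"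
    unfolding Omega_level_def
    by (intro hull_minimal) (auto simp: less_top[symmetric] top_ereal_def)
  then show "M \<in> Omega I" "objective I x M < \<infinity>" using assms by auto
qed

section \<open>Absorbing the weights into one factor\<close>

definition scale_columns ::
  "('r::finite, 'i::finite) factor \<Rightarrow> real^'r \<Rightarrow> ('r, 'i) factor" where
  "scale_columns A l = (\<chi> i r. A $ i $ r * l $ r)"

text \<open>
  The scaling ambiguity. It is used in both directions: to read the result of a block step as a
  model with weights, and to turn a change of the weights or of a factor into a competitor in a
  block subproblem.
\<close>

lemma block_objective_scale_columns:
  "block_objective I x A n (scale_columns C l) =
    objective I x (l, \<chi> m. if m = n then C else A $ m)"
proof -
  have "(\<Prod>m\<in>UNIV. (if m = n then scale_columns C l else A $ m) $ i m $ r) =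
      l $ r * (\<Prod>m\<in>UNIV. (if m = n then C else A $ m) $ i m $ r)" for i r
    by (subst (1 2) prod.remove[of UNIV n]) (auto simp: scale_columns_def intro!: prod.cong)
  then show ?thesis
    by (simp add: block_objective_def objective_def entry_def)
qed

lemma block_objective_scaled_factor:
  "block_objective I x A n (scale_columns (A $ n) l) = objective I x (l, A)"
proof -
  have "(\<chi> m. if m = n then A $ n else A $ m) = A" by (simp add: vec_eq_iff)
  then show ?thesis by (simp add: block_objective_scale_columns)
qed

lemma scale_columns_nonneg:
  "A \<in> nonneg_matrices J \<Longrightarrow> l \<in> Omega_weights \<Longrightarrow> scale_columns A l \<in> nonneg_matrices J"
  by (auto simp: scale_columns_def nonneg_matrices_def Omega_weights_def vec_eq_iff)

lemma column_sums_nonneg: "B \<in> nonneg_matrices J \<Longrightarrow> column_sums J B \<in> Omega_weights"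
  by (auto simp: column_sums_def nonneg_matrices_def Omega_weights_def sum_nonneg)

lemma column_zero_iff:
  fixes B :: "('r::finite, 'i::finite) factor"
  assumes "B \<in> nonneg_matrices J"
  shows "(\<forall>i\<in>J. B $ i $ r = 0) \<longleftrightarrow> column_sums J B $ r = 0"
  using assms by (simp add: column_sums_def nonneg_matrices_def sum_nonneg_eq_0_iff)

lemma scale_columns_normalization:
  assumes "column_normalization J B A" "B \<in> nonneg_matrices J"
  shows "scale_columns A (column_sums J B) = B"
proof -
  have "A $ i $ r * column_sums J B $ r = B $ i $ r" for i r
  proof (cases "i \<in> J")
    case True
    then show ?thesis
      using assms column_zero_iff[OF assms(2), of r]
      by (auto simp: column_normalization_def split: if_splits)
  next
    case False
    then show ?thesis using assms by (simp add: column_normalization_def nonneg_matrices_def)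
  qed
  then show ?thesis by (simp add: scale_columns_def vec_eq_iff)
qed

lemma normalization_in_Omega_factor:
  fixes B :: "('r::finite, 'i::finite) factor"
  assumes "column_normalization J B A" "B \<in> nonneg_matrices J"
  shows "A \<in> Omega_factor J"
proof -
  have "(\<Sum>i\<in>J. A $ i $ r) = 1" for r
  proof (cases "\<forall>i\<in>J. B $ i $ r = 0")
    case True
    then show ?thesis using assms(1) by (simp add: column_normalization_def)
  next
    case False
    then have "(\<Sum>i\<in>J. A $ i $ r) = (\<Sum>i\<in>J. B $ i $ r / column_sums J B $ r)"
      using assms(1) by (auto simp: column_normalization_def intro!: sum.cong)
    also have "\<dots> = column_sums J B $ r / column_sums J B $ r"
      by (simp add: column_sums_def flip: sum_divide_distrib)
    also have "\<dots> = 1" using False column_zero_iff[OF assms(2), of r] by simp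
    finally show ?thesis .
  qed
  then show ?thesis
    using assms(1) by (simp add: Omega_factor_eq column_normalization_def column_sums_def vec_eq_iff)
qed

section \<open>Stability of the block minimizers\<close>

text \<open>
  Summing a rank one tensor over all indices factors into the column sums.
\<close>

lemma sum_entries:
  fixes I :: "'n::finite \<Rightarrow> 'i::finite set"
  shows "(\<Sum>i\<in>multi_indices I. entry (l, A) i) =
    (\<Sum>r\<in>UNIV. l $ r * (\<Prod>n\<in>UNIV. column_sums (I n) (A $ n) $ r))"
proof -
  have "multi_indices I = PiE UNIV I" by (auto simp: multi_indices_def PiE_def)
  then show ?thesis
    unfolding entry_def column_sums_def
    by (subst sum.swap) (simp add: prod_sum_PiE flip: sum_distrib_left)
qed

lemma norm_le_sum_entries: "norm B \<le> (\<Sum>i\<in>UNIV. \<Sum>r\<in>UNIV. \<bar>B $ i $ r\<bar>)"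
  for B :: "('r::finite, 'i::finite) factor"
proof -
  have "norm B \<le> (\<Sum>i\<in>UNIV. norm (B $ i))"
    unfolding norm_vec_def by (rule L2_set_le_sum) simp
  also have "\<dots> \<le> (\<Sum>i\<in>UNIV. \<Sum>r\<in>UNIV. \<bar>B $ i $ r\<bar>)"
    by (intro sum_mono norm_le_l1_cart)
  finally show ?thesis .
qed

text \<open>
  With column stochastic other factors the entries of the model sum to those of \<open>B\<close>, and each
  entry is controlled by its loss. The bound does not depend on the other factors, so it is
  uniform along the iterates.
\<close>

lemma block_objective_coercive:
  fixes A :: "('r::finite, 'i::finite, 'n::finite) factors"
  assumes data: "\<And>i. i \<in> multi_indices I \<Longrightarrow> 0 \<le> x i"
    and A: "\<And>m. A $ m \<in> Omega_factor (I m)"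
    and B: "B \<in> nonneg_matrices (I n)"
    and le: "block_objective I x A n B \<le> ereal c"
  shows "norm B \<le> 2 * (c + (\<Sum>i\<in>multi_indices I. x i * ln (2 * x i)))"
proof -
  define M where "M = ((\<chi> r. 1) :: real^'r, \<chi> m. if m = n then B else A $ m)"
  have nnM: "nonneg_ktensor M"
    using A B by (auto simp: M_def nonneg_ktensor_def Omega_factor_eq nonneg_matrices_def)
  have "(\<Sum>i\<in>multi_indices I. entry M i) =
      (\<Sum>r\<in>UNIV. \<Prod>m\<in>UNIV. column_sums (I m) (if m = n then B else A $ m) $ r)"
    by (simp add: M_def sum_entries)
  also have "\<dots> = (\<Sum>r\<in>UNIV. column_sums (I n) B $ r)"
    by (subst prod.remove[of UNIV n]) (use A in \<open>auto simp: Omega_factor_eq intro!: prod.neutral\<close>)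
  also have "\<dots> = (\<Sum>r\<in>UNIV. \<Sum>i\<in>UNIV. B $ i $ r)"
  proof (rule sum.cong)
    show "column_sums (I n) B $ r = (\<Sum>i\<in>UNIV. B $ i $ r)" for r
      unfolding column_sums_def using B
      by (simp add: nonneg_matrices_def) (rule sum.mono_neutral_left, auto)
  qed simp
  also have "\<dots> = (\<Sum>i\<in>UNIV. \<Sum>r\<in>UNIV. \<bar>B $ i $ r\<bar>)"
    by (subst sum.swap) (use B in \<open>auto simp: nonneg_matrices_def intro!: sum.cong\<close>)
  finally have norm: "norm B \<le> (\<Sum>i\<in>multi_indices I. entry M i)"
    using norm_le_sum_entries[of B] by simp
  have "ereal (\<Sum>i\<in>multi_indices I. entry M i / 2 - x i * ln (2 * x i)) \<le> objective I x M"
    unfolding objective_def sum_ereal[symmetric]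
    by (intro sum_mono loss_lower_bound data entry_nonneg nnM)
  also have "\<dots> \<le> ereal c" using le by (simp add: M_def block_objective_def)
  finally have "(\<Sum>i\<in>multi_indices I. entry M i) / 2 - (\<Sum>i\<in>multi_indices I. x i * ln (2 * x i)) \<le> c"
    by (simp add: sum_subtractf sum_divide_distrib)
  with norm show ?thesis by simp
qed

text \<open>
  Otherwise some subsequence stays away from \<open>l\<close> inside the compact set, and has itself a
  cluster point, different from \<open>l\<close>.
\<close>

lemma tendsto_if_unique_cluster_point:
  fixes f :: "nat \<Rightarrow> 'a::metric_space"
  assumes K: "compact K" "\<forall>\<^sub>F k in sequentially. f k \<in> K"
    and unique: "\<And>r l'. strict_mono r \<Longrightarrow> (f \<circ> r) \<longlonglongrightarrow> l' \<Longrightarrow> l' = l"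
  shows "f \<longlonglongrightarrow> l"
proof (rule ccontr)
  assume "\<not> f \<longlonglongrightarrow> l"
  then obtain e where e: "0 < e" "\<not> (\<forall>\<^sub>F k in sequentially. dist (f k) l < e)"
    by (auto simp: tendsto_iff)
  have "\<not> (\<forall>\<^sub>F k in sequentially. f k \<in> K \<longrightarrow> dist (f k) l < e)"
  proof
    assume "\<forall>\<^sub>F k in sequentially. f k \<in> K \<longrightarrow> dist (f k) l < e"
    with K(2) have "\<forall>\<^sub>F k in sequentially. dist (f k) l < e" by eventually_elim simp
    with e(2) show False ..
  qed
  then obtain r :: "nat \<Rightarrow> nat" where r: "strict_mono r" "\<And>k. f (r k) \<in> K" "\<And>k. e \<le> dist (f (r k)) l"
    using not_eventually_sequentiallyD by (fastforce simp: not_less)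
  obtain s l' where s: "strict_mono s" "((f \<circ> r) \<circ> s) \<longlonglongrightarrow> l'"
    using K(1) r(2) unfolding compact_eq_seq_compact_metric seq_compact_def by (metis comp_apply)
  have "l' = l"
    using unique[of "r \<circ> s" l'] r(1) s by (simp add: strict_mono_o comp_assoc)
  then have "(\<lambda>k. dist (f (r (s k))) l) \<longlonglongrightarrow> 0"
    using s(2) tendsto_dist_iff by (fastforce simp: o_def)
  then have "e \<le> 0"
    by (rule LIMSEQ_le_const) (use r(3) in auto)
  with e(1) show False by simp
qed

lemma tendsto_block_objective:
  fixes S :: "'a \<Rightarrow> ('r::finite, 'i::finite, 'n::finite) factors"
  assumes data: "\<And>i. i \<in> multi_indices I \<Longrightarrow> 0 \<le> x i"
    and S: "\<And>k m. S k $ m \<in> nonneg_matrices (I m)" "(S \<longlongrightarrow> T) F"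
    and T: "\<And>m. T $ m \<in> nonneg_matrices (I m)"
    and B: "\<And>k. B k \<in> nonneg_matrices (I n)" "(B \<longlongrightarrow> C) F" "C \<in> nonneg_matrices (I n)"
  shows "((\<lambda>k. block_objective I x (S k) n (B k)) \<longlongrightarrow> block_objective I x T n C) F"
  unfolding block_objective_def
proof (rule tendsto_objective)
  show "((\<lambda>k. (\<chi> r. 1, \<chi> m. if m = n then B k else S k $ m)) \<longlongrightarrow>
      (\<chi> r. 1, \<chi> m. if m = n then C else T $ m)) F"
  proof (intro tendsto_Pair tendsto_const)
    show "((\<lambda>k. \<chi> m. if m = n then B k else S k $ m) \<longlongrightarrow> (\<chi> m. if m = n then C else T $ m)) F"
    proof (rule vec_tendstoI)
      fix m show "((\<lambda>k. (\<chi> m. if m = n then B k else S k $ m) $ m) \<longlongrightarrow>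
          (\<chi> m. if m = n then C else T $ m) $ m) F"
        using B(2) tendsto_vec_nth[OF S(2)] by simp
    qed
  qed
qed (use S T B in \<open>auto simp: nonneg_ktensor_def nonneg_matrices_def data\<close>)

lemma block_minimizer_le:
  "block_minimizer I x A n B \<Longrightarrow> C \<in> nonneg_matrices (I n) \<Longrightarrow>
    block_objective I x A n B \<le> block_objective I x A n C"
  by (auto simp: block_minimizer_def is_arg_min_def not_less)

lemma block_minimizer_nonneg: "block_minimizer I x A n B \<Longrightarrow> B \<in> nonneg_matrices (I n)"
  by (simp add: block_minimizer_def is_arg_min_def)

lemma block_objective_not_MInfty [simp]: "block_objective I x A n B \<noteq> - \<infinity>"
  by (simp add: block_objective_def)

lemma block_minimizer_unique:
  assumes strict: "block_strictly_convex I x A n"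
    and B: "block_minimizer I x A n B" and C: "C \<in> nonneg_matrices (I n)"
    and eq: "block_objective I x A n C = block_objective I x A n B"
    and fin: "block_objective I x A n B < \<infinity>"
  shows "C = B"
proof (rule ccontr)
  let ?g = "block_objective I x A n"
  assume "C \<noteq> B"
  obtain v where v: "?g B = ereal v"
    using fin by (cases "?g B") (auto simp: block_objective_not_MInfty)
  have B_in: "B \<in> nonneg_matrices (I n)" using B by (rule block_minimizer_nonneg)
  have half: "0 < (1/2 :: real)" "(1/2 :: real) < 1" by auto
  have "?g ((1/2) *\<^sub>R C + (1 - 1/2) *\<^sub>R B) < ereal (1/2) * ?g C + ereal (1 - 1/2) * ?g B"
    using strict \<open>C \<noteq> B\<close> C B_in eq fin half
    unfolding block_strictly_convex_def strictly_convex_on_def by metis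
  also have "\<dots> = ?g B" using v eq by simp
  finally have "?g ((1/2) *\<^sub>R C + (1 - 1/2) *\<^sub>R B) < ?g B" .
  moreover have "(1/2) *\<^sub>R C + (1 - 1/2) *\<^sub>R B \<in> nonneg_matrices (I n)"
    using C B_in by (intro convexD[OF convex_nonneg_matrices]) auto
  ultimately show False using block_minimizer_le[OF B] by (metis not_less)
qed

text \<open>
  Stability of argmins. Minimality passes to the limit against each fixed competitor by continuity
  in the other factors; boundedness and uniqueness of the limiting minimizer then give
  convergence. The limit of the values is what singles out \<open>C\<close>; in a sweep it comes from
  monotonicity of the objective.
\<close>

lemma block_minimizers_converge:
  fixes S :: "nat \<Rightarrow> ('r::finite, 'i::finite, 'n::finite) factors"
  assumes data: "\<And>i. i \<in> multi_indices I \<Longrightarrow> 0 \<le> x i"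
    and S: "\<And>k m. S k $ m \<in> Omega_factor (I m)" "S \<longlonglongrightarrow> T"
    and T: "\<And>m. T $ m \<in> Omega_factor (I m)"
    and min: "\<And>k. block_minimizer I x (S k) n (B k)"
    and C: "C \<in> nonneg_matrices (I n)"
    and vals: "(\<lambda>k. block_objective I x (S k) n (B k)) \<longlonglongrightarrow> block_objective I x T n C"
    and fin: "block_objective I x T n C < \<infinity>"
    and strict: "block_strictly_convex I x T n"
  shows "block_minimizer I x T n C" "B \<longlonglongrightarrow> C"
proof -
  let ?g = "\<lambda>A. block_objective I x A n"
  have S': "S k $ m \<in> nonneg_matrices (I m)" and T': "T $ m \<in> nonneg_matrices (I m)" for k m
    using S(1) T by (auto simp: Omega_factor_eq)
  have B_in: "B k \<in> nonneg_matrices (I n)" for k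
    using min by (rule block_minimizer_nonneg)
  have "?g T C \<le> ?g T D" if D: "D \<in> nonneg_matrices (I n)" for D
  proof (rule LIMSEQ_le[OF vals])
    show "(\<lambda>k. ?g (S k) D) \<longlonglongrightarrow> ?g T D"
      by (rule tendsto_block_objective[OF data S' S(2) T' D tendsto_const D])
    show "\<exists>N. \<forall>k\<ge>N. ?g (S k) (B k) \<le> ?g (S k) D"
      using block_minimizer_le[OF min D] by auto
  qed
  then show C_min: "block_minimizer I x T n C"
    using C by (auto simp: block_minimizer_def is_arg_min_def not_less)
  obtain v where v: "?g T C = ereal v"
    using fin by (cases "?g T C") (auto simp: block_objective_not_MInfty)
  show "B \<longlonglongrightarrow> C"
  proof (rule tendsto_if_unique_cluster_point)
    let ?c = "2 * (v + 1 + (\<Sum>i\<in>multi_indices I. x i * ln (2 * x i)))"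
    show "compact (cball (0 :: ('r, 'i) factor) ?c)" by simp
    have "\<forall>\<^sub>F k in sequentially. ?g (S k) (B k) < ereal (v + 1)"
      using order_tendstoD(2)[OF vals, of "ereal (v + 1)"] v by simp
    then show "\<forall>\<^sub>F k in sequentially. B k \<in> cball 0 ?c"
    proof eventually_elim
      case (elim k)
      then show ?case
        using block_objective_coercive[where I = I and x = x and c = "v + 1", 
            OF data S(1) B_in less_imp_le[OF elim]] by simp
    qed
  next
    fix r D assume r: "strict_mono r" "(B \<circ> r) \<longlonglongrightarrow> D"
    have D: "D \<in> nonneg_matrices (I n)"
      using closed_sequentially[OF closed_nonneg_matrices _ r(2)] B_in by simp
    have "(\<lambda>k. ?g ((S \<circ> r) k) ((B \<circ> r) k)) \<longlonglongrightarrow> ?g T D"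
      by (rule tendsto_block_objective[OF data _ LIMSEQ_subseq_LIMSEQ[OF S(2) r(1)] T' _ r(2) D])
        (simp_all add: S' B_in)
    moreover have "(\<lambda>k. ?g ((S \<circ> r) k) ((B \<circ> r) k)) \<longlonglongrightarrow> ?g T C"
      using LIMSEQ_subseq_LIMSEQ[OF vals r(1)] by (simp add: o_def)
    ultimately have "?g T D = ?g T C" by (rule LIMSEQ_unique)
    then show "D = C" by (rule block_minimizer_unique[OF strict C_min D _ fin])
  qed
qed

section \<open>Descent within one outer iteration\<close>

text \<open>
  After step \<open>n\<close> the model has the new factors up to mode \<open>n\<close> and the weights
  \<open>L n\<close>, the column sums of the block minimizer. These weights and the old factor of the next
  mode form a competitor in the next subproblem, so the values decrease along the sweep.
\<close>

lemma cpapr_iteration_descent: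
  fixes M M' :: "('r::finite, 'i::finite, 'n::{finite,linorder}) ktensor"
  assumes iter: "cpapr_iteration I x M M'" and M: "M \<in> Omega I"
  obtains B :: "('r, 'i, 'n) factors" where
    "\<And>n. block_minimizer I x (sweep_factors (snd M) (snd M') n) n (B $ n)"
    "\<And>n. column_normalization (I n) (B $ n) (snd M' $ n)"
    "\<And>n. block_objective I x (sweep_factors (snd M) (snd M') n) n (B $ n) \<le> objective I x M"
    "\<And>n. objective I x M' \<le> block_objective I x (sweep_factors (snd M) (snd M') n) n (B $ n)"
    "M' \<in> Omega I"
proof -
  obtain B :: "('r, 'i, 'n) factors" where
    min: "\<And>n. block_minimizer I x (sweep_factors (snd M) (snd M') n) n (B $ n)" and
    norm: "\<And>n. column_normalization (I n) (B $ n) (snd M' $ n)" and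
    weights: "fst M' = column_sums (I (Max UNIV)) (B $ Max UNIV)"
    using iter unfolding cpapr_iteration_def by blast
  let ?S = "sweep_factors (snd M) (snd M')"
  define V where "V n = block_objective I x (?S n) n (B $ n)" for n
  define L where "L n = column_sums (I n) (B $ n)" for n
  have B_in: "B $ n \<in> nonneg_matrices (I n)" for n
    using min by (rule block_minimizer_nonneg)
  have L_in: "L n \<in> Omega_weights" for n
    unfolding L_def by (intro column_sums_nonneg B_in)
  have A_in: "snd M $ n \<in> nonneg_matrices (I n)" "fst M \<in> Omega_weights" for n
    using M by (auto simp: Omega_def Omega_factor_eq)
  have V_eq: "V n = objective I x (L n, \<chi> m. if m \<le> n then snd M' $ m else snd M $ m)" for n
  proof -
    have "V n = block_objective I x (?S n) n (scale_columns (snd M' $ n) (L n))"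
      using scale_columns_normalization[OF norm B_in] by (simp add: V_def L_def)
    also have "\<dots> = objective I x (L n, \<chi> m. if m = n then snd M' $ n else ?S n $ m)"
      by (rule block_objective_scale_columns)
    also have "(\<chi> m. if m = n then snd M' $ n else ?S n $ m) =
        (\<chi> m. if m \<le> n then snd M' $ m else snd M $ m)"
      by (auto simp: vec_eq_iff sweep_factors_def)
    finally show ?thesis .
  qed
  have V_le: "V n \<le> objective I x (l, ?S n)" if "l \<in> Omega_weights" for n l
  proof -
    have "scale_columns (?S n $ n) l \<in> nonneg_matrices (I n)"
      using that A_in by (simp add: sweep_factors_def scale_columns_nonneg)
    from block_minimizer_le[OF min this] show ?thesis
      by (simp add: V_def block_objective_scaled_factor)
  qed
  \<comment> \<open>\<open>p\<close> is the predecessor of \<open>n\<close>: the sweep at \<open>n\<close> uses the factors left by step \<open>p\<close>.\<close>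
  have step: "V n \<le> V p" if "p < n" "\<And>m. m < n \<Longrightarrow> m \<le> p" for n p
  proof -
    have "?S n = (\<chi> m. if m \<le> p then snd M' $ m else snd M $ m)"
      using that by (auto simp: vec_eq_iff sweep_factors_def)
    then show ?thesis using V_le[OF L_in[of p], of n] by (simp add: V_eq[of p])
  qed
  have chain: "V n \<le> objective I x M \<and> (\<forall>m\<le>n. V n \<le> V m)" for n
  proof (induction "card {m. m < n}" arbitrary: n rule: less_induct)
    case less
    show ?case
    proof (cases "{m. m < n} = {}")
      case True
      then have min_n: "m \<le> n \<longleftrightarrow> m = n" and "\<not> m < n" for m
        by (auto simp: le_less)
      then have "?S n = snd M" by (simp add: sweep_factors_def vec_eq_iff)
      then show ?thesis using V_le[OF A_in(2), of n] min_n by simp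
    next
      case False
      define p where "p = Max {m. m < n}"
      have "p \<in> {m. m < n}" unfolding p_def using False by (intro Max_in) auto
      then have p: "p < n" by simp
      have p_max: "m \<le> p" if "m < n" for m unfolding p_def using that by simp
      have "card {m. m < p} < card {m. m < n}"
        using p by (intro psubset_card_mono) auto
      from less[OF this] show ?thesis
        using step[OF p p_max] p_max by (metis le_less order.trans order.refl)
    qed
  qed
  have last: "V (Max UNIV) = objective I x M'"
  proof -
    have "(\<chi> m. if m \<le> Max UNIV then snd M' $ m else snd M $ m) = snd M'"
      by (simp add: vec_eq_iff)
    then show ?thesis by (simp add: V_eq L_def flip: weights)
  qed
  have "M' \<in> Omega I"
    using weights L_in[of "Max UNIV"] normalization_in_Omega_factor[OF norm B_in]
    by (auto simp: Omega_def L_def mem_Times_iff)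
  moreover have "objective I x M' \<le> V n" for n
    using chain[of "Max UNIV"] last by simp
  moreover have "V n \<le> objective I x M" for n
    using chain by blast
  ultimately show thesis using min norm unfolding V_def by (intro that)
qed

section \<open>First order conditions\<close>

lemma entry_differentiable: "(\<lambda>M. entry M i) differentiable (at M)"
  for M :: "('r::finite, 'i::finite, 'n::finite) ktensor"
proof -
  have 1: "(\<lambda>M :: ('r, 'i, 'n) ktensor. fst M $ r) differentiable (at M)" for r
    by (intro bounded_linear_imp_differentiable bounded_linear_compose[OF bounded_linear_vec_nth]
        bounded_linear_fst)
  have 2: "(\<lambda>M :: ('r, 'i, 'n) ktensor. snd M $ n $ j $ r) differentiable (at M)" for n j r
    by (intro bounded_linear_imp_differentiable bounded_linear_compose[OF bounded_linear_vec_nth]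
        bounded_linear_snd)
  have "(\<lambda>M :: ('r, 'i, 'n) ktensor. \<Prod>n\<in>UNIV. snd M $ n $ i n $ r) differentiable (at M)" for r
    by (rule differentiableI[OF has_derivative_prod[OF 2[unfolded frechet_derivative_works]]])
  with 1 show ?thesis
    unfolding entry_def by (intro differentiable_sum differentiable_mult ballI) auto
qed

lemma eventually_objective_finite:
  fixes M :: "('r::finite, 'i::finite, 'n::finite) ktensor"
  assumes "objective I x M < \<infinity>"
  shows "\<forall>\<^sub>F X in nhds M. objective I x X < \<infinity>"
proof -
  have "\<forall>\<^sub>F X in nhds M. x i \<noteq> 0 \<longrightarrow> 0 < entry X i" if "i \<in> multi_indices I" for i
  proof (cases "x i = 0")
    case False
    then have "0 < entry M i" using assms that unfolding objective_finite_iff by simp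
    then have "\<forall>\<^sub>F X in nhds M. 0 < entry X i"
      by (rule order_tendstoD(1)[OF tendsto_entry[OF filterlim_ident]])
    then show ?thesis by (simp add: eventually_mono)
  qed simp
  then show ?thesis
    unfolding objective_finite_iff by (simp add: eventually_ball_finite)
qed

lemma objective_differentiable:
  fixes M :: "('r::finite, 'i::finite, 'n::finite) ktensor"
  assumes fin: "objective I x M < \<infinity>"
  shows "(\<lambda>X. real_of_ereal (objective I x X)) differentiable (at M)"
proof -
  let ?G = "\<lambda>X i. entry X i - (if x i = 0 then 0 else x i * ln (entry X i))"
  have "(\<lambda>X. ?G X i) differentiable (at M)" if i: "i \<in> multi_indices I" for i
  proof (cases "x i = 0")
    case True
    then show ?thesis by (simp add: entry_differentiable)
  next
    case False
    then have pos: "0 < entry M i" using fin i unfolding objective_finite_iff by simp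
    obtain D where D: "((\<lambda>X. entry X i) has_derivative D) (at M)"
      using entry_differentiable unfolding differentiable_def by blast
    have "(\<lambda>X. ln (entry X i)) differentiable (at M)"
      unfolding differentiable_def using has_derivative_ln[OF pos D] by blast
    then have "(\<lambda>X. entry X i - x i * ln (entry X i)) differentiable (at M)"
      by (intro differentiable_diff differentiable_mult differentiable_const entry_differentiable)
    then show ?thesis using False by simp
  qed
  then have "(\<lambda>X. \<Sum>i\<in>multi_indices I. ?G X i) differentiable (at M)"
    by (intro differentiable_sum) auto
  then obtain D where D: "((\<lambda>X. \<Sum>i\<in>multi_indices I. ?G X i) has_derivative D) (at M)"
    unfolding differentiable_def by blast
  have "\<forall>\<^sub>F X in nhds M. (\<Sum>i\<in>multi_indices I. ?G X i) = real_of_ereal (objective I x X)"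
    using eventually_objective_finite[OF fin]
    by eventually_elim (subst objective_eq_real, assumption, simp)
  then have "(\<forall>\<^sub>F X in at M. (\<Sum>i\<in>multi_indices I. ?G X i) = real_of_ereal (objective I x X)) \<and>
      (\<Sum>i\<in>multi_indices I. ?G M i) = real_of_ereal (objective I x M)"
    by (simp only: eventually_nhds_conv_at)
  note conj = conjunct1[OF this] conjunct2[OF this]
  from has_derivative_transform_eventually[OF D conj UNIV_I] show ?thesis
    by (rule differentiableI)
qed

text \<open>
  The scalar KKT condition: \<open>c\<close> is the slack that the constraint leaves to the left of the
  minimum, and a derivative can be positive only if there is none.
\<close>

lemma derivative_at_constrained_minimum:
  fixes h :: "real \<Rightarrow> real"
  assumes h: "(h has_real_derivative d) (at 0)" and c: "0 \<le> c"
    and min: "\<forall>\<^sub>F t in nhds 0. - c \<le> t \<longrightarrow> h 0 \<le> h t"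
  shows "0 \<le> d" "d * c = 0"
proof -
  have "\<exists>e>0. \<forall>t. dist t 0 < e \<longrightarrow> - c \<le> t \<longrightarrow> h 0 \<le> h t"
    using min by (simp only: eventually_nhds_metric)
  then obtain e where e: "0 < e" "\<And>t. dist t 0 < e \<Longrightarrow> - c \<le> t \<Longrightarrow> h 0 \<le> h t"
    by blast
  show d: "0 \<le> d"
  proof (rule ccontr)
    assume "\<not> 0 \<le> d"
    then have "\<exists>s>0. \<forall>t>0. t < s \<longrightarrow> h (0 + t) < h 0"
      using h by (intro DERIV_neg_dec_right) auto
    then obtain s where s: "0 < s" "\<And>t. 0 < t \<Longrightarrow> t < s \<Longrightarrow> h t < h 0"
      by (metis add_0)
    define t where "t = min s e / 2"
    have "0 < t" "t < s" "t < e" using s(1) e(1) by (auto simp: t_def min_def)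
    then show False using s(2)[of t] e(2)[of t] c by (simp add: dist_real_def)
  qed
  show "d * c = 0"
  proof (rule ccontr)
    assume "d * c \<noteq> 0"
    then have pos: "0 < d" "0 < c" using c d by auto
    then have "\<exists>s>0. \<forall>t>0. t < s \<longrightarrow> h (0 - t) < h 0"
      using h by (intro DERIV_pos_inc_left) auto
    then obtain s where s: "0 < s" "\<And>t. 0 < t \<Longrightarrow> t < s \<Longrightarrow> h (- t) < h 0"
      by (metis diff_0)
    define t where "t = min s (min e c) / 2"
    have "0 < t" "t < s" "t < e" "t < c" using s(1) e(1) pos by (auto simp: t_def min_def)
    then show False using s(2)[of t] e(2)[of "- t"] by (simp add: dist_real_def)
  qed
qed

text \<open>
  The objective may be infinite far from \<open>M\<close>, where its real part is meaningless; only points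
  near \<open>M\<close>, at which it is finite, enter the comparison.
\<close>

lemma objective_line_derivative:
  fixes M E :: "('r::finite, 'i::finite, 'n::finite) ktensor"
  assumes D: "((\<lambda>X. real_of_ereal (objective I x X)) has_derivative D) (at M)"
    and fin: "objective I x M < \<infinity>" and c: "0 \<le> c"
    and min: "\<And>t. - c \<le> t \<Longrightarrow> objective I x M \<le> objective I x (M + t *\<^sub>R E)"
  shows "0 \<le> D E" "D E * c = 0"
proof -
  define h where "h t = real_of_ereal (objective I x (M + t *\<^sub>R E))" for t
  have real: "ereal (real_of_ereal (objective I x X)) = objective I x X"
    if "objective I x X < \<infinity>" for X :: "('r, 'i, 'n) ktensor"
    using that by (cases "objective I x X") auto
  have line: "((\<lambda>t. M + t *\<^sub>R E) has_derivative (\<lambda>t. t *\<^sub>R E)) (at 0)"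
    by (auto intro!: derivative_eq_intros)
  have "(h has_derivative (\<lambda>t. D (t *\<^sub>R E))) (at 0)"
    unfolding h_def using has_derivative_compose[OF line, of _ D] D by simp
  moreover have "D (t *\<^sub>R E) = D E * t" for t
    using linear_cmul[OF has_derivative_linear[OF D]] by simp
  ultimately have h: "(h has_real_derivative D E) (at 0)"
    by (simp add: has_field_derivative_def)
  have "((\<lambda>t. M + t *\<^sub>R E) \<longlongrightarrow> M + 0 *\<^sub>R E) (nhds 0)"
    by (intro tendsto_intros filterlim_ident)
  then have "\<forall>\<^sub>F t in nhds 0. objective I x (M + t *\<^sub>R E) < \<infinity>"
    using eventually_compose_filterlim[OF eventually_objective_finite[OF fin]] by simp
  then have "\<forall>\<^sub>F t in nhds 0. - c \<le> t \<longrightarrow> h 0 \<le> h t"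
  proof eventually_elim
    case (elim t)
    have "h 0 \<le> h t" if "- c \<le> t"
    proof -
      have "ereal (h 0) = objective I x M" "ereal (h t) = objective I x (M + t *\<^sub>R E)"
        unfolding h_def using real[OF fin] real[OF elim] by simp_all
      then have "ereal (h 0) \<le> ereal (h t)" using min[OF that] by simp
      then show ?thesis by simp
    qed
    then show ?case by simp
  qed
  from derivative_at_constrained_minimum[OF h c this] show "0 \<le> D E" "D E * c = 0" by auto
qed

definition weight_direction :: "'r \<Rightarrow> ('r::finite, 'i::finite, 'n::finite) ktensor" where
  "weight_direction r = (axis r 1, 0)"

definition factor_direction ::
  "'n \<Rightarrow> 'i \<Rightarrow> 'r \<Rightarrow> ('r::finite, 'i::finite, 'n::finite) ktensor" where
  "factor_direction n i r = (0, axis n (axis i (axis r 1)))"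

lemma ktensor_expansion:
  fixes H :: "('r::finite, 'i::finite, 'n::finite) ktensor"
  shows "H = (\<Sum>r\<in>UNIV. fst H $ r *\<^sub>R weight_direction r) +
    (\<Sum>n\<in>UNIV. \<Sum>i\<in>UNIV. \<Sum>r\<in>UNIV. snd H $ n $ i $ r *\<^sub>R factor_direction n i r)"
proof -
  have expand: "(\<Sum>n\<in>UNIV. axis n (A $ n)) = A" for A :: "('a::real_vector)^('m::finite)"
    by (simp add: vec_eq_iff axis_def if_distrib if_distribR cong: if_cong)
  have scale: "c *\<^sub>R axis n v = axis n (c *\<^sub>R v)"
    for c :: real and n :: "'m::finite" and v :: "'a::real_vector"
    by (simp add: vec_eq_iff axis_def)
  have sum: "(\<Sum>r\<in>J. axis n (v r)) = axis n (sum v J)"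
    for n :: "'m::finite" and v :: "'b \<Rightarrow> 'a::real_vector" and J
    by (induction J rule: infinite_finite_induct) (auto simp: vec_eq_iff axis_def)
  show ?thesis
    by (intro prod_eqI)
      (simp_all add: weight_direction_def factor_direction_def fst_sum snd_sum scale sum expand)
qed

text \<open>
  The derivative \<open>D\<close> of the objective is determined by its values in the coordinate directions.
  Taking these values as multipliers of the nonnegativity constraints makes the linear part of the
  Lagrangian equal to \<open>D\<close>, so that its derivative vanishes, while blockwise minimality gives
  sign and complementarity. Both minima range over nonnegative arguments with arbitrary column
  sums, which is why the multipliers of the column sums are zero.
\<close>

lemma KKT_point_of_blockwise_minimum:
  fixes M :: "('r::finite, 'i::finite, 'n::finite) ktensor"
  assumes M: "M \<in> Omega I" and fin: "objective I x M < \<infinity>"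
    and min_weights: "\<And>l. l \<in> Omega_weights \<Longrightarrow> objective I x M \<le> objective I x (l, snd M)"
    and min_factor: "\<And>n A. A \<in> nonneg_matrices (I n) \<Longrightarrow>
      objective I x M \<le> objective I x (fst M, \<chi> m. if m = n then A else snd M $ m)"
  shows "KKT_point I x M"
proof -
  obtain D where D: "((\<lambda>X. real_of_ereal (objective I x X)) has_derivative D) (at M)"
    using objective_differentiable[OF fin] unfolding differentiable_def by blast
  interpret D: linear D by (rule has_derivative_linear[OF D])
  have nn: "nonneg_ktensor M" using M by (rule Omega_imp_nonneg)
  have wt: "0 \<le> D (weight_direction r) \<and> D (weight_direction r) * fst M $ r = 0" for r
  proof -
    have "objective I x M \<le> objective I x (M + t *\<^sub>R weight_direction r)" if "- (fst M $ r) \<le> t" for t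
    proof -
      have "fst M + t *\<^sub>R axis r 1 \<in> Omega_weights"
        using nn that by (auto simp: Omega_weights_def nonneg_ktensor_def axis_def)
      from min_weights[OF this] show ?thesis
        by (simp add: weight_direction_def plus_prod_def)
    qed
    then show ?thesis
      using objective_line_derivative[OF D fin, of "fst M $ r" "weight_direction r"] nn
      by (simp add: nonneg_ktensor_def)
  qed
  have fac: "0 \<le> D (factor_direction n i r) \<and> D (factor_direction n i r) * snd M $ n $ i $ r = 0"
    if i: "i \<in> I n" for n i r
  proof -
    have "objective I x M \<le> objective I x (M + t *\<^sub>R factor_direction n i r)"
      if "- (snd M $ n $ i $ r) \<le> t" for t
    proof -
      have "snd M $ n + t *\<^sub>R axis i (axis r 1) \<in> nonneg_matrices (I n)"
        using M that i
        by (auto simp: Omega_def Omega_factor_eq nonneg_matrices_def axis_def)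
      note min_factor[OF this]
      also have "(fst M, \<chi> m. if m = n then snd M $ n + t *\<^sub>R axis i (axis r 1) else snd M $ m) =
          M + t *\<^sub>R factor_direction n i r"
        by (auto simp: prod_eq_iff factor_direction_def vec_eq_iff axis_def)
      finally show ?thesis .
    qed
    then show ?thesis
      using objective_line_derivative[OF D fin, of "snd M $ n $ i $ r" "factor_direction n i r"] nn
      by (simp add: nonneg_ktensor_def)
  qed
  \<comment> \<open>Rows outside \<open>I n\<close> have no multiplier, but no index of the tensor refers to them.\<close>
  have outside: "D (factor_direction n i r) = 0" if i: "i \<notin> I n" for n i r
  proof -
    have "objective I x (M + t *\<^sub>R factor_direction n i r) = objective I x M" for t
    proof -
      have "entry (M + t *\<^sub>R factor_direction n i r) j = entry M j" if "j \<in> multi_indices I" for j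
      proof -
        have "j n \<noteq> i" using that i by (auto simp: multi_indices_def)
        then have "snd (M + t *\<^sub>R factor_direction n i r) $ m $ j m = snd M $ m $ j m" for m
          by (auto simp: factor_direction_def axis_def vec_eq_iff)
        moreover have "fst (M + t *\<^sub>R factor_direction n i r) = fst M"
          by (simp add: factor_direction_def)
        ultimately show ?thesis unfolding entry_def by (simp only:)
      qed
      then show ?thesis by (simp add: objective_def)
    qed
    \<comment> \<open>The objective is constant in this direction, so any positive slack, such as one, is available.\<close>
    then have "D (factor_direction n i r) * 1 = 0"
      by (intro objective_line_derivative(2)[OF D fin]) auto
    then show ?thesis by simp
  qed
  define \<mu> :: "real^'r" where "\<mu> = (\<chi> r. D (weight_direction r))"
  define \<upsilon> :: "real^'r^'i^'n" where "\<upsilon> = (\<chi> n i r. D (factor_direction n i r))"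
  have expand: "D H = (\<Sum>r\<in>UNIV. \<mu> $ r * fst H $ r) +
      (\<Sum>n\<in>UNIV. \<Sum>i\<in>I n. \<Sum>r\<in>UNIV. \<upsilon> $ n $ i $ r * snd H $ n $ i $ r)" for H
  proof -
    have "D H = (\<Sum>r\<in>UNIV. \<mu> $ r * fst H $ r) +
        (\<Sum>n\<in>UNIV. \<Sum>i\<in>UNIV. \<Sum>r\<in>UNIV. \<upsilon> $ n $ i $ r * snd H $ n $ i $ r)"
      by (subst ktensor_expansion)
        (simp add: D.add D.sum D.scale \<mu>_def \<upsilon>_def mult.commute)
    also have "(\<Sum>n\<in>UNIV. \<Sum>i\<in>UNIV. \<Sum>r\<in>UNIV. \<upsilon> $ n $ i $ r * snd H $ n $ i $ r) =
        (\<Sum>n\<in>UNIV. \<Sum>i\<in>I n. \<Sum>r\<in>UNIV. \<upsilon> $ n $ i $ r * snd H $ n $ i $ r)"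
      by (intro sum.cong[OF refl] sum.mono_neutral_right) (auto simp: \<upsilon>_def outside)
    finally show ?thesis .
  qed
  have "lagrangian I x \<mu> \<upsilon> 0 = (\<lambda>X. real_of_ereal (objective I x X) - D X)"
    by (simp add: fun_eq_iff lagrangian_def expand)
  moreover have "(D has_derivative D) (at M)"
    by (rule bounded_linear_imp_has_derivative[OF has_derivative_bounded_linear[OF D]])
  ultimately have "(lagrangian I x \<mu> \<upsilon> 0 has_derivative (\<lambda>_. 0)) (at M)"
    using has_derivative_diff[OF D] by fastforce
  then show ?thesis
    unfolding KKT_point_def using M fin wt fac
    by (intro conjI exI[of _ \<mu>] exI[of _ \<upsilon>] exI[of _ 0]) (auto simp: \<mu>_def \<upsilon>_def)
qed

section \<open>Limit points of the iterates\<close>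

text \<open>
  Positivity of the weights enters here: the column sums of \<open>B k\<close> are eventually positive, so
  the arbitrary choice for zero columns does not occur, and dividing by them is continuous.
\<close>

lemma tendsto_column_normalization:
  fixes B A :: "nat \<Rightarrow> ('r::finite, 'i::finite) factor"
  assumes norm: "\<And>k. column_normalization J (B k) (A k)"
    and lim: "B \<longlonglongrightarrow> scale_columns A0 l"
    and A0: "A0 \<in> Omega_factor J" and l: "\<And>r. 0 < l $ r"
  shows "A \<longlonglongrightarrow> A0"
proof (intro vec_tendstoI)
  fix i r
  have sums: "column_sums J (scale_columns A0 l) $ r = l $ r"
    using A0 by (simp add: Omega_factor_eq column_sums_def scale_columns_def vec_eq_iff
        flip: sum_distrib_right)
  have sums_lim: "(\<lambda>k. column_sums J (B k) $ r) \<longlonglongrightarrow> l $ r"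
    unfolding sums[symmetric] by (simp add: column_sums_def) (intro tendsto_intros lim)
  show "(\<lambda>k. A k $ i $ r) \<longlonglongrightarrow> A0 $ i $ r"
  proof (cases "i \<in> J")
    case True
    have "(\<lambda>k. B k $ i $ r / column_sums J (B k) $ r) \<longlonglongrightarrow> scale_columns A0 l $ i $ r / l $ r"
      using l[of r] by (intro tendsto_intros lim sums_lim) simp
    moreover have "scale_columns A0 l $ i $ r / l $ r = A0 $ i $ r"
      using l[of r] by (simp add: scale_columns_def)
    moreover have "\<forall>\<^sub>F k in sequentially. B k $ i $ r / column_sums J (B k) $ r = A k $ i $ r"
      using order_tendstoD(1)[OF sums_lim l]
    proof eventually_elim
      case (elim k)
      have "\<not> (\<forall>i\<in>J. B k $ i $ r = 0)"
      proof
        assume "\<forall>i\<in>J. B k $ i $ r = 0"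
        then have "column_sums J (B k) $ r = 0" by (simp add: column_sums_def)
        with elim show False by simp
      qed
      then show ?case using norm[of k] True by (auto simp: column_normalization_def)
    qed
    ultimately show ?thesis by (auto intro: Lim_transform_eventually)
  next
    case False
    then show ?thesis
      using norm A0 by (simp add: column_normalization_def Omega_factor_eq nonneg_matrices_def)
  qed
qed

theorem theorem3p5:
  fixes I :: "'n::{finite,linorder} \<Rightarrow> 'i::finite set"
    and x :: "('i, 'n) tensor"
    and M :: "nat \<Rightarrow> ('r::finite, 'i, 'n) ktensor"
    and Mstar :: "('r, 'i, 'n) ktensor"
    and \<zeta> :: real
    and \<phi> :: "nat \<Rightarrow> nat"
  assumes nonempty_modes: "\<And>n. I n \<noteq> {}"
    and data_nonneg: "\<And>i. i \<in> multi_indices I \<Longrightarrow> 0 \<le> x i"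
    and zeta_pos: "0 < \<zeta>"
    and start: "M 0 \<in> Omega_level I x \<zeta>"
    and cpapr: "cpapr_sequence I x M"
    and strict_iterates:
      "\<And>k n. block_strictly_convex I x (sweep_factors (snd (M k)) (snd (M (Suc k))) n) n"
    and strict_limit: "\<And>n. block_strictly_convex I x (snd Mstar) n"
    and limit_point: "strict_mono \<phi>" "(M \<circ> \<phi>) \<longlonglongrightarrow> Mstar"
    and weights_pos: "\<And>r. 0 < fst Mstar $ r"
  shows "KKT_point I x Mstar"
proof -
  let ?f = "objective I x"
  let ?S = "\<lambda>k. sweep_factors (snd (M k)) (snd (M (Suc k)))"
  have iter: "cpapr_iteration I x (M k) (M (Suc k))" for k
    using cpapr by (simp add: cpapr_sequence_def)
  have M_in: "M k \<in> Omega I" for k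
  proof (induction k)
    case (Suc k)
    then show ?case using cpapr_iteration_descent[OF iter] by metis
  qed (use start in \<open>rule Omega_level_imp_finite\<close>)
  have "\<exists>B. \<forall>n. block_minimizer I x (?S k n) n (B $ n) \<and>
      column_normalization (I n) (B $ n) (snd (M (Suc k)) $ n) \<and>
      block_objective I x (?S k n) n (B $ n) \<le> ?f (M k) \<and>
      ?f (M (Suc k)) \<le> block_objective I x (?S k n) n (B $ n)" for k
    using cpapr_iteration_descent[OF iter M_in, of k] by metis
  then obtain B where
    min: "\<And>k n. block_minimizer I x (?S k n) n (B k $ n)" and
    norm: "\<And>k n. column_normalization (I n) (B k $ n) (snd (M (Suc k)) $ n)" and
    upper: "\<And>k n. block_objective I x (?S k n) n (B k $ n) \<le> ?f (M k)" and
    lower: "\<And>k n. ?f (M (Suc k)) \<le> block_objective I x (?S k n) n (B k $ n)"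
    by metis
  have Mstar: "Mstar \<in> Omega I"
    using closed_sequentially[OF closed_Omega _ limit_point(2)] M_in by simp
  then have Astar: "snd Mstar $ n \<in> Omega_factor (I n)" "fst Mstar \<in> Omega_weights" for n
    by (auto simp: Omega_def)
  have decreasing: "decseq (\<lambda>k. ?f (M k))"
    using lower upper by (intro decseq_SucI) (metis order.trans)
  have lim: "(\<lambda>k. ?f (M (\<phi> k))) \<longlonglongrightarrow> ?f Mstar"
    using tendsto_objective[where I = I and x = x, OF data_nonneg limit_point(2)]
      Omega_imp_nonneg[OF M_in] Omega_imp_nonneg[OF Mstar]
    by simp
  \<comment> \<open>Every iterate, also outside the subsequence, lies above the limit value; this bounds the values
    inside the sweeps from below.\<close>
  have below: "?f Mstar \<le> ?f (M j)" for j
  proof (rule LIMSEQ_le_const2[OF lim])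
    show "\<exists>N. \<forall>k\<ge>N. ?f (M (\<phi> k)) \<le> ?f (M j)"
      using decseqD[OF decreasing] seq_suble[OF limit_point(1)] by (meson order.trans)
  qed
  have fin: "?f Mstar < \<infinity>"
    using below[of 0] Omega_level_imp_finite(2)[OF start] by (rule le_less_trans)
  have V_lim: "(\<lambda>k. block_objective I x (?S (\<phi> k) n) n (B (\<phi> k) $ n)) \<longlonglongrightarrow> ?f Mstar" for n
  proof (rule tendsto_sandwich[OF _ _ tendsto_const lim])
    show "\<forall>\<^sub>F k in sequentially. ?f Mstar \<le> block_objective I x (?S (\<phi> k) n) n (B (\<phi> k) $ n)"
      by (intro always_eventually allI order.trans[OF below lower])
    show "\<forall>\<^sub>F k in sequentially. block_objective I x (?S (\<phi> k) n) n (B (\<phi> k) $ n) \<le> ?f (M (\<phi> k))"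
      by (intro always_eventually allI upper)
  qed
  define C where "C n = scale_columns (snd Mstar $ n) (fst Mstar)" for n
  have C_in: "C n \<in> nonneg_matrices (I n)" for n
    using Astar by (simp add: C_def Omega_factor_eq scale_columns_nonneg)
  have C_val: "block_objective I x (snd Mstar) n (C n) = ?f Mstar" for n
    by (simp add: C_def block_objective_scaled_factor)
  have A_lim: "(\<lambda>k. snd (M (\<phi> k))) \<longlonglongrightarrow> snd Mstar"
    using tendsto_snd[OF limit_point(2)] by (simp add: o_def)
  have step: "block_minimizer I x (snd Mstar) n (C n) \<and>
      (\<lambda>k. snd (M (Suc (\<phi> k))) $ n) \<longlonglongrightarrow> snd Mstar $ n" for n
  proof (induction "card {m. m < n}" arbitrary: n rule: less_induct)
    case less
    have prev: "(\<lambda>k. snd (M (Suc (\<phi> k))) $ m) \<longlonglongrightarrow> snd Mstar $ m" if "m < n" for m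
    proof -
      have "card {j. j < m} < card {j. j < n}"
        using that by (intro psubset_card_mono) auto
      from less[OF this] show ?thesis by simp
    qed
    have S_lim: "(\<lambda>k. ?S (\<phi> k) n) \<longlonglongrightarrow> snd Mstar"
    proof (rule vec_tendstoI)
      fix m show "(\<lambda>k. ?S (\<phi> k) n $ m) \<longlonglongrightarrow> snd Mstar $ m"
        using prev tendsto_vec_nth[OF A_lim] by (cases "m < n") (simp_all add: sweep_factors_def)
    qed
    have S_in: "?S (\<phi> k) n $ m \<in> Omega_factor (I m)" for k m
      using M_in[of "\<phi> k"] M_in[of "Suc (\<phi> k)"] by (auto simp: sweep_factors_def Omega_def)
    have V_lim': "(\<lambda>k. block_objective I x (?S (\<phi> k) n) n (B (\<phi> k) $ n)) \<longlonglongrightarrow>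
        block_objective I x (snd Mstar) n (C n)"
      unfolding C_val by (rule V_lim)
    have fin': "block_objective I x (snd Mstar) n (C n) < \<infinity>"
      unfolding C_val by (rule fin)
    note conv = block_minimizers_converge[where I = I and x = x,
        OF data_nonneg S_in S_lim Astar(1) min C_in V_lim' fin' strict_limit]
    have "(\<lambda>k. snd (M (Suc (\<phi> k))) $ n) \<longlonglongrightarrow> snd Mstar $ n"
      using conv(2) by (intro tendsto_column_normalization[OF norm _ Astar(1) weights_pos])
        (simp add: C_def)
    with conv(1) show ?case by simp
  qed
  have block_min: "?f Mstar \<le> block_objective I x (snd Mstar) n D" if "D \<in> nonneg_matrices (I n)" for n D
    using block_minimizer_le[OF conjunct1[OF step] that] by (simp add: C_val)
  show ?thesis
  proof (rule KKT_point_of_blockwise_minimum[OF Mstar fin])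
    fix l :: "real^'r" assume "l \<in> Omega_weights"
    then have "scale_columns (snd Mstar $ n) l \<in> nonneg_matrices (I n)" for n
      using Astar by (simp add: Omega_factor_eq scale_columns_nonneg)
    from block_min[OF this] show "?f Mstar \<le> ?f (l, snd Mstar)"
      by (simp add: block_objective_scaled_factor)
  next
    fix n and A :: "('r, 'i) factor" assume "A \<in> nonneg_matrices (I n)"
    then have "scale_columns A (fst Mstar) \<in> nonneg_matrices (I n)"
      using Astar by (simp add: scale_columns_nonneg)
    from block_min[OF this]
    show "?f Mstar \<le> ?f (fst Mstar, \<chi> m. if m = n then A else snd Mstar $ m)"
      by (simp add: block_objective_scale_columns)
  qed
qed

end
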